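(* Let $n\ge 2$ be an integer, let $A$ be a unital algebra over a commutative unital ring $\mathcal{R}$, and let $\mathcal{A}=M_2(A)$ be the full matrix algebra of $2\times 2$ matrices over $A$. Suppose that $\mathcal{A}$ is $2$- and $(n-1)$-torsion free, and that $A$ is a commutative algebra or a noncommutative prime algebra. Then every Lie $n$-derivation on $M_2(A)$ is standard.
   Context: Linear means $\mathcal{R}$-linear; $\mathcal{Z}(\mathcal{A})$ is the centre of $\mathcal{A}$. An algebra $A$ is prime if $aAb=\{0\}$ implies $a=0$ or $b=0$. For a positive integer $k$, $\mathcal{A}$ is $k$-torsion free if $kx=0$ implies $x=0$ for each $x\in\mathcal{A}$. $[x,y]=xy-yx$. Define $p_1(x_1)=x_1$ and $p_n(x_1,\dots,x_n)=[p_{n-1}(x_1,\dots,x_{n-1}),x_n]$ for $n\ge2$; for $n\ge 2$, $p_n(x_1,\dots,x_n)$ is called an $(n-1)$-th commutator. A linear map $\varphi:\mathcal{A}\to\mathcal{A}$ is a Lie $n$-derivation if $\varphi(p_n(x_1,\dots,x_n))=\sum_{i=1}^n p_n(x_1,\dots,x_{i-1},\varphi(x_i),x_{i+1},\dots,x_n)$ for all $x_1,\dots,x_n\in\mathcal{A}$. A Lie $n$-derivation is standard if it equals $h+\tau$ with $h$ a derivation on $\mathcal{A}$ (linear, $h(xy)=h(x)y+xh(y)$) and $\tau$ a linear mapping from $\mathcal{A}$ into $\mathcal{Z}(\mathcal{A})$ vanishing on all $(n-1)$-th commutators of $\mathcal{A}$. *)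

theory Defs
  imports "HOL-Analysis.Finite_Cartesian_Product"
begin

locale unital_algebra = module scl
  for scl :: "'r::comm_ring_1 \<Rightarrow> 'a::ring_1 \<Rightarrow> 'a" +
  assumes scale_mult_left: "scl r x * y = scl r (x * y)"
    and scale_mult_right: "x * scl r y = scl r (x * y)"

text \<open>The product is an explicit argument in what follows: on \<open>'a ^ 'n ^ 'n\<close> the overloaded
  \<open>(*)\<close> is the entrywise product, whereas the algebra of matrices has product \<open>(**)\<close>.\<close>

definition commutator :: "('b \<Rightarrow> 'b \<Rightarrow> 'b) \<Rightarrow> 'b \<Rightarrow> 'b \<Rightarrow> 'b::ab_group_add" where
  "commutator mul x y = mul x y - mul y x"

text \<open>\<open>lie_p mul n x\<close> is \<open>p\<^sub>n(x\<^sub>1, \<dots>, x\<^sub>n)\<close>; only the entries of \<open>x\<close> at \<open>1, \<dots>, n\<close>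
  matter, and the value at \<open>n = 0\<close> is junk.\<close>

fun lie_p :: "('b \<Rightarrow> 'b \<Rightarrow> 'b) \<Rightarrow> nat \<Rightarrow> (nat \<Rightarrow> 'b) \<Rightarrow> 'b::ab_group_add" where
  "lie_p mul 0 x = 0"
| "lie_p mul (Suc 0) x = x 1"
| "lie_p mul (Suc (Suc k)) x = commutator mul (lie_p mul (Suc k) x) (x (Suc (Suc k)))"

definition algebra_centre :: "('b \<Rightarrow> 'b \<Rightarrow> 'b) \<Rightarrow> 'b set" where
  "algebra_centre mul = {z. \<forall>x. mul z x = mul x z}"

definition prime_algebra :: "('b \<Rightarrow> 'b \<Rightarrow> 'b::zero) \<Rightarrow> bool" where
  "prime_algebra mul \<longleftrightarrow> (\<forall>a b. (\<forall>x. mul (mul a x) b = 0) \<longrightarrow> a = 0 \<or> b = 0)"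

definition commutative_algebra :: "('b \<Rightarrow> 'b \<Rightarrow> 'b) \<Rightarrow> bool" where
  "commutative_algebra mul \<longleftrightarrow> (\<forall>x y. mul x y = mul y x)"

text \<open>The integer multiple \<open>k x\<close> is the \<open>k\<close>-fold sum of \<open>x\<close>.\<close>

definition torsion_free :: "'b::ab_group_add itself \<Rightarrow> nat \<Rightarrow> bool" where
  "torsion_free _ k \<longleftrightarrow> (\<forall>x::'b. (\<Sum>i<k. x) = 0 \<longrightarrow> x = 0)"

definition derivation ::
    "('r::comm_ring_1 \<Rightarrow> 'b \<Rightarrow> 'b) \<Rightarrow> ('b \<Rightarrow> 'b \<Rightarrow> 'b) \<Rightarrow> ('b::ab_group_add \<Rightarrow> 'b) \<Rightarrow> bool" where
  "derivation scl mul h \<longleftrightarrow>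
     module_hom scl scl h \<and> (\<forall>x y. h (mul x y) = mul (h x) y + mul x (h y))"

definition Lie_n_derivation ::
    "('r::comm_ring_1 \<Rightarrow> 'b \<Rightarrow> 'b) \<Rightarrow> ('b \<Rightarrow> 'b \<Rightarrow> 'b) \<Rightarrow> nat \<Rightarrow> ('b::ab_group_add \<Rightarrow> 'b) \<Rightarrow> bool" where
  "Lie_n_derivation scl mul n \<phi> \<longleftrightarrow>
     module_hom scl scl \<phi> \<and>
     (\<forall>x. \<phi> (lie_p mul n x) = (\<Sum>i=1..n. lie_p mul n (x(i := \<phi> (x i)))))"

definition standard_map ::
    "('r::comm_ring_1 \<Rightarrow> 'b \<Rightarrow> 'b) \<Rightarrow> ('b \<Rightarrow> 'b \<Rightarrow> 'b) \<Rightarrow> nat \<Rightarrow> ('b::ab_group_add \<Rightarrow> 'b) \<Rightarrow> bool" where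
  "standard_map scl mul n \<phi> \<longleftrightarrow>
     (\<exists>h \<tau>. derivation scl mul h \<and>
        module_hom scl scl \<tau> \<and> range \<tau> \<subseteq> algebra_centre mul \<and>
        (\<forall>x. \<tau> (lie_p mul n x) = 0) \<and>
        (\<forall>x. \<phi> x = h x + \<tau> x))"

definition mat_scale :: "('r \<Rightarrow> 'a \<Rightarrow> 'a) \<Rightarrow> 'r \<Rightarrow> 'a ^ 'n ^ 'm \<Rightarrow> 'a ^ 'n ^ 'm" where
  "mat_scale scl r X = (\<chi> i j. scl r (X $ i $ j))"

context unital_algebra
begin

lemma module_mat_scale: "module (mat_scale scl :: 'r \<Rightarrow> 'a ^ 'n ^ 'm \<Rightarrow> 'a ^ 'n ^ 'm)"
  by unfold_locales
    (simp_all add: mat_scale_def vec_eq_iff scale_right_distrib scale_left_distrib)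

lemma mat_scale_mult_left:
  fixes X :: "'a ^ 'n ^ 'm" and Y :: "'a ^ 'p ^ 'n"
  shows "mat_scale scl r X ** Y = mat_scale scl r (X ** Y)"
  by (simp add: mat_scale_def matrix_matrix_mult_def vec_eq_iff scale_mult_left scale_sum_right)

lemma mat_scale_mult_right:
  fixes X :: "'a ^ 'n ^ 'm" and Y :: "'a ^ 'p ^ 'n"
  shows "X ** mat_scale scl r Y = mat_scale scl r (X ** Y)"
  by (simp add: mat_scale_def matrix_matrix_mult_def vec_eq_iff scale_mult_right scale_sum_right)

end

end

theory Submission
  imports Defs "HOL-Analysis.Cartesian_Space"
begin

text \<open>Write \<open>e\<close> for the first diagonal matrix unit and let \<open>\<phi>\<close> be a Lie \<open>n\<close>-derivation.
  Bracketing with \<open>e\<close> kills the diagonal of a matrix and multiplies its two off-diagonal corners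
  by \<open>-1\<close> and \<open>1\<close>. Hence filling up a commutator of length one, two or three with entries \<open>e\<close> keeps its
  off-diagonal part, up to the sign of one corner. If \<open>\<phi> e\<close> is central, the identity for \<open>\<phi>\<close> on such
  \<open>n\<close>-fold commutators becomes an ordinary Leibniz rule for the off-diagonal part of short ones, and
  everything is read off from it.

  Subtracting the inner derivation given by a suitable off-diagonal matrix makes \<open>\<phi> e\<close> diagonal.
  Then the identity on \<open>[x, e, \<dots>, e]\<close> contains the bracket of \<open>x\<close> with \<open>\<phi> e\<close> exactly \<open>n - 1\<close>
  times, so \<open>(n - 1)\<close>-torsion freeness forces \<open>\<phi> e\<close> to be central (\<open>unit_central\<close>).

  After that, \<open>\<phi>\<close> preserves diagonal matrices and both off-diagonal corners. That a corner is not
  mapped to the opposite one follows from a comparison of signs: on \<open>[x, e, \<dots>, e]\<close> if \<open>n\<close> is even,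
  and on a commutator \<open>[x, y, z, e, \<dots>, e]\<close> with \<open>x, y, z\<close> off-diagonal if \<open>n\<close> is odd
  (\<open>corner_12_to_12\<close>). So \<open>\<phi>\<close> is given by maps of \<open>A\<close>: it sends \<open>a\<close> in the upper diagonal place
  to \<open>diag(\<alpha> a, \<beta> a)\<close>, \<open>d\<close> in the lower one to \<open>diag(\<gamma> d, \<delta> d)\<close>, and acts on the corners by
  \<open>\<mu>\<close> and \<open>\<nu>\<close>.

  Elements of the two diagonal places commute, which makes \<open>[\<beta> x, y] = [x, \<gamma> y]\<close> a central element
  for all \<open>x\<close> and \<open>y\<close>. In a commutative or prime algebra this is possible only if \<open>\<beta>\<close> and \<open>\<gamma>\<close> have
  central values (\<open>\<beta>_\<gamma>_central\<close>); this is where the hypothesis on \<open>A\<close> enters. The products of a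
  diagonal and an off-diagonal element then show that \<open>D = \<alpha> - \<beta>\<close> is a derivation of \<open>A\<close> and express
  \<open>\<mu>\<close>, \<open>\<nu>\<close> and \<open>\<delta> - \<gamma>\<close> through \<open>D\<close>, \<open>\<mu> 1\<close> and \<open>\<nu> 1\<close>. Finally \<open>\<mu> 1 + \<nu> 1 = 0\<close> by
  \<open>2\<close>-torsion freeness (\<open>\<mu>_\<nu>_one\<close>). Altogether \<open>\<phi>\<close> is the entrywise derivation \<open>D\<close>, plus an inner
  derivation, plus the central map \<open>X \<mapsto> (\<beta> X\<^sub>1\<^sub>1 + \<gamma> X\<^sub>2\<^sub>2) I\<close> (\<open>psi_decomposition\<close>). The central map
  vanishes on \<open>n\<close>-fold commutators, since both \<open>\<phi>\<close> and derivations are Lie \<open>n\<close>-derivations, while a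
  central entry annihilates a commutator.\<close>

section \<open>Two-by-two matrices in coordinates\<close>

definition mat2 :: "'a \<Rightarrow> 'a \<Rightarrow> 'a \<Rightarrow> 'a \<Rightarrow> 'a ^ 2 ^ 2" where
  "mat2 a b c d = (\<chi> i j. if i = 1 then (if j = 1 then a else b) else (if j = 1 then c else d))"

lemma mat2_nth [simp]:
  "mat2 a b c d $ 1 $ 1 = a" "mat2 a b c d $ 1 $ 2 = b"
  "mat2 a b c d $ 2 $ 1 = c" "mat2 a b c d $ 2 $ 2 = d"
  by (simp_all add: mat2_def)

lemma mat2_eta: "mat2 (X $ 1 $ 1) (X $ 1 $ 2) (X $ 2 $ 1) (X $ 2 $ 2) = X"
  by (simp add: vec_eq_iff forall_2)

lemma mat2_eq_iff:
  "X = Y \<longleftrightarrow> X $ 1 $ 1 = Y $ 1 $ 1 \<and> X $ 1 $ 2 = Y $ 1 $ 2 \<and> X $ 2 $ 1 = Y $ 2 $ 1 \<and> X $ 2 $ 2 = Y $ 2 $ 2"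
  for X Y :: "'a ^ 2 ^ 2"
  by (auto simp add: vec_eq_iff forall_2)

lemma mat2_mult_nth:
  fixes X Y :: "'a::semiring_1 ^ 2 ^ 2"
  shows "(X ** Y) $ i $ j = X $ i $ 1 * Y $ 1 $ j + X $ i $ 2 * Y $ 2 $ j"
  by (simp add: matrix_matrix_mult_def sum_2)

abbreviation bracket :: "'a::ring_1 ^ 'n ^ 'n \<Rightarrow> 'a ^ 'n ^ 'n \<Rightarrow> 'a ^ 'n ^ 'n" where
  "bracket \<equiv> commutator (**)"

lemma bracket_nth:
  fixes X Y :: "'a::ring_1 ^ 2 ^ 2"
  shows "bracket X Y $ i $ j =
    X $ i $ 1 * Y $ 1 $ j + X $ i $ 2 * Y $ 2 $ j - (Y $ i $ 1 * X $ 1 $ j + Y $ i $ 2 * X $ 2 $ j)"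
  by (simp add: commutator_def mat2_mult_nth)

lemma bracket_mat2 [simp]:
  "bracket (mat2 a b c d) (mat2 a' b' c' d') =
    mat2 (a * a' + b * c' - (a' * a + b' * c)) (a * b' + b * d' - (a' * b + b' * d))
      (c * a' + d * c' - (c' * a + d' * c)) (c * b' + d * d' - (c' * b + d' * d))"
  by (simp add: mat2_eq_iff[of "bracket _ _"] bracket_nth)

lemma mat2_add [simp]: "mat2 a b c d + mat2 a' b' c' d' = mat2 (a + a') (b + b') (c + c') (d + d')"
  and mat2_diff [simp]: "mat2 a b c d - mat2 a' b' c' d' = mat2 (a - a') (b - b') (c - c') (d - d')"
  and mat2_minus [simp]: "- mat2 a b c d = mat2 (- a) (- b) (- c) (- d)"
  for a b c d :: "'a::ring_1"
  by (simp_all add: mat2_eq_iff)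

lemma mat2_inject [simp]:
  "mat2 a b c d = mat2 a' b' c' d' \<longleftrightarrow> a = a' \<and> b = b' \<and> c = c' \<and> d = d'"
  by (simp add: mat2_eq_iff)

lemma mat2_zero: "mat2 0 0 0 0 = 0"
  by (simp add: mat2_eq_iff)

lemma mat2_eq_0_iff [simp]: "mat2 a b c d = 0 \<longleftrightarrow> a = 0 \<and> b = 0 \<and> c = 0 \<and> d = 0"
  by (simp add: mat2_eq_iff)

section \<open>Leibniz sums of iterated commutators\<close>

lemma bracket_add_left: "bracket (X + Y) Z = bracket X Z + bracket Y Z"
  and bracket_diff_left: "bracket (X - Y) Z = bracket X Z - bracket Y Z"
  and bracket_diff_right: "bracket Z (X - Y) = bracket Z X - bracket Z Y"
  by (simp_all add: commutator_def vec_eq_iff matrix_matrix_mult_def sum.distrib sum_subtractf algebra_simps)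

lemma bracket_zero [simp]: "bracket 0 Z = 0" "bracket Z 0 = 0"
  by (simp_all add: commutator_def vec_eq_iff matrix_matrix_mult_def)

lemma bracket_sum_left: "bracket (\<Sum>i\<in>I. F i) Z = (\<Sum>i\<in>I. bracket (F i) Z)"
  by (induction I rule: infinite_finite_induct) (simp_all add: bracket_add_left)

lemma lie_p_cong:
  "(\<And>i. 1 \<le> i \<Longrightarrow> i \<le> n \<Longrightarrow> x i = y i) \<Longrightarrow> lie_p mul n x = lie_p mul n y"
  by (induction mul n x rule: lie_p.induct) simp_all

definition leibniz_sum ::
    "('a ^ 'n ^ 'n \<Rightarrow> 'a ^ 'n ^ 'n) \<Rightarrow> nat \<Rightarrow> (nat \<Rightarrow> 'a ^ 'n ^ 'n) \<Rightarrow> 'a::ring_1 ^ 'n ^ 'n" where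
  "leibniz_sum \<phi> n x = (\<Sum>i=1..n. lie_p (**) n (x(i := \<phi> (x i))))"

lemma leibniz_sum_0 [simp]: "leibniz_sum \<phi> 0 x = 0"
  by (simp add: leibniz_sum_def)

lemma leibniz_sum_1 [simp]: "leibniz_sum \<phi> (Suc 0) x = \<phi> (x 1)"
  by (simp add: leibniz_sum_def)

text \<open>This recursion is what makes the defining identity usable: it turns the sum over all positions
  into an induction along the commutator.\<close>

lemma leibniz_sum_Suc:
  "leibniz_sum \<phi> (Suc (Suc k)) x =
     bracket (leibniz_sum \<phi> (Suc k) x) (x (Suc (Suc k)))
     + bracket (lie_p (**) (Suc k) x) (\<phi> (x (Suc (Suc k))))"
proof -
  have early: "lie_p (**) (Suc (Suc k)) (x(i := \<phi> (x i))) =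
      bracket (lie_p (**) (Suc k) (x(i := \<phi> (x i)))) (x (Suc (Suc k)))" if "i \<in> {1..Suc k}" for i
    using that by simp
  have last: "lie_p (**) (Suc k) (x(Suc (Suc k) := c)) = lie_p (**) (Suc k) x" for c
    by (rule lie_p_cong) simp
  show ?thesis
    by (simp add: leibniz_sum_def last early bracket_add_left bracket_sum_left)
qed

lemma leibniz_sum_diff:
  "leibniz_sum (\<lambda>X. \<phi> X - \<psi> X) n x = leibniz_sum \<phi> n x - leibniz_sum \<psi> n x"
proof (induction n)
  case (Suc n)
  then show ?case
    by (cases n) (simp_all add: leibniz_sum_Suc bracket_diff_left bracket_diff_right)
qed simp

lemma leibniz_sum_derivation:
  assumes "\<And>X Y. \<delta> (bracket X Y) = bracket (\<delta> X) Y + bracket X (\<delta> Y)" and "n \<ge> 1"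
  shows "leibniz_sum \<delta> n x = \<delta> (lie_p (**) n x)"
  using assms(2)
proof (induction n)
  case (Suc n)
  then show ?case by (cases n) (simp_all add: leibniz_sum_Suc assms(1))
qed simp

lemma leibniz_sum_central:
  assumes "\<And>X Y. bracket (\<tau> X) Y = 0" and "\<And>X Y. bracket Y (\<tau> X) = 0" and "n \<ge> 2"
  shows "leibniz_sum \<tau> n x = 0"
  using assms(3)
proof (induction n)
  case (Suc n)
  then obtain k where n: "n = Suc k" by (cases n) auto
  show ?case using Suc.IH assms(1,2) by (cases k) (simp_all add: n leibniz_sum_Suc)
qed simp

lemma matrix_add_rdistrib: "(Y + Z) ** X = Y ** X + Z ** X"
  and matrix_diff_ldistrib: "X ** (Y - Z) = X ** Y - X ** Z"
  and matrix_diff_rdistrib: "(Y - Z) ** X = Y ** X - Z ** X"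
  for X Y Z :: "'a::ring_1 ^ 'n ^ 'n"
  by (simp_all add: vec_eq_iff matrix_matrix_mult_def sum.distrib sum_subtractf algebra_simps)

lemma inner_derivation_mult:
  "bracket (X ** Y) G = bracket X G ** Y + X ** bracket Y G"
  by (simp add: commutator_def matrix_diff_ldistrib matrix_diff_rdistrib matrix_mul_assoc)

lemma inner_derivation_bracket:
  "bracket (bracket X Y) G = bracket (bracket X G) Y + bracket X (bracket Y G)"
  by (simp add: commutator_def matrix_diff_ldistrib matrix_diff_rdistrib matrix_mul_assoc)

section \<open>Brackets with the first matrix unit\<close>

lemma neg_one_power_cancel [simp]: "(-1) ^ k * u = (-1) ^ k * v \<longleftrightarrow> u = (v::'a::ring_1)"
  by (cases "even k") simp_all

abbreviation ad :: "'a::ring_1 ^ 2 ^ 2 \<Rightarrow> 'a ^ 2 ^ 2" where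
  "ad X \<equiv> bracket X (mat2 1 0 0 0)"

lemma ad_power_offdiagonal: "(ad ^^ k) (mat2 0 b c 0) = mat2 0 ((-1) ^ k * b) c 0"
  by (induction k) simp_all

lemma ad_power_Suc: "(ad ^^ Suc k) (mat2 a b c d) = mat2 0 (- ((-1) ^ k * b)) c 0"
  by (induction k) simp_all

lemma ad_power_offdiagonal_part:
  assumes "k > 0 \<or> a = 0 \<and> d = 0"
  shows "(ad ^^ k) (mat2 a b c d) = mat2 0 ((-1) ^ k * b) c 0"
  using assms ad_power_offdiagonal ad_power_Suc by (cases k) auto

section \<open>Hypotheses on the entries\<close>

text \<open>Let \<open>c = [b, y]\<close>. Since \<open>[b, y b] = c b\<close> is central as well, \<open>0 = [c b, y] = c\<^sup>2\<close>; a central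
  element of square zero generates a nilpotent ideal, so it vanishes in a prime ring.\<close>

lemma commuting_if_central_commutators:
  assumes "commutative_algebra ((*) :: 'a::ring_1 \<Rightarrow> 'a \<Rightarrow> 'a) \<or> prime_algebra ((*) :: 'a \<Rightarrow> 'a \<Rightarrow> 'a)"
    and central: "\<And>y z. (b * y - y * b) * z = z * (b * y - y * (b::'a))"
  shows "b * y = y * b"
  using assms(1)
proof
  assume "commutative_algebra ((*) :: 'a \<Rightarrow> 'a \<Rightarrow> 'a)"
  then show ?thesis by (simp add: commutative_algebra_def)
next
  assume prime: "prime_algebra ((*) :: 'a \<Rightarrow> 'a \<Rightarrow> 'a)"
  define c where "c = b * y - y * b"
  have c_central: "c * z = z * c" for z unfolding c_def by (rule central)
  have "c * b = b * (y * b) - (y * b) * b" by (simp add: c_def algebra_simps)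
  then have "c * b * y = y * (c * b)" using central[of "y * b" y] by simp
  then have "c * c = 0" using c_central[of y] by (simp add: c_def right_diff_distrib flip: mult.assoc)
  then have "c * z * c = 0" for z using c_central[of z] by (metis mult.assoc mult_zero_right)
  then have "c = 0" using prime unfolding prime_algebra_def by blast
  then show ?thesis by (simp add: c_def)
qed

lemma torsion_free_entries:
  assumes "torsion_free TYPE('a::ring_1 ^ 'm ^ 'n) k" and "of_nat k * a = (0::'a)"
  shows "a = 0"
proof -
  have "(\<Sum>i<k. \<chi> i j. a) = (0 :: 'a ^ 'm ^ 'n)"
    using assms(2) by (simp add: vec_eq_iff sum_component del: sum_constant) simp
  then have "(\<chi> i j. a) = (0 :: 'a ^ 'm ^ 'n)"
    using assms(1) unfolding torsion_free_def by blast
  then show ?thesis by (simp add: vec_eq_iff)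
qed

section \<open>Lie derivations that are diagonal at the first matrix unit\<close>

text \<open>The last assumption is the common consequence of commutativity and primeness: a derivation
  \<open>y \<mapsto> [b, y]\<close> with central values is zero.\<close>

locale normalised_Lie_derivation =
  fixes \<psi> :: "'a::ring_1 ^ 2 ^ 2 \<Rightarrow> 'a ^ 2 ^ 2" and n :: nat
  assumes add: "\<psi> (X + Y) = \<psi> X + \<psi> Y"
    and n_ge_2: "n \<ge> 2"
    and Lie: "\<psi> (lie_p (**) n x) = leibniz_sum \<psi> n x"
    and unit_diagonal: "\<psi> (mat2 1 0 0 0) $ 1 $ 2 = 0" "\<psi> (mat2 1 0 0 0) $ 2 $ 1 = 0"
    and two_torsion: "a + a = 0 \<Longrightarrow> a = (0::'a)"
    and n_torsion: "of_nat (n - 1) * a = 0 \<Longrightarrow> a = (0::'a)"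
    and central_commutators:
      "(\<And>y z. (b * y - y * b) * z = z * (b * y - y * b)) \<Longrightarrow> b * y = y * (b::'a)"
begin

lemma zero: "\<psi> 0 = 0"
  using add[of 0 0] by simp

lemma minus: "\<psi> (- X) = - \<psi> X"
  using add[of X "- X"] by (simp add: zero eq_neg_iff_add_eq_0 add.commute)

lemma diff: "\<psi> (X - Y) = \<psi> X - \<psi> Y"
  using add[of X "- Y"] by (simp add: minus)

lemma zero_if_eq_neg: "a = - a \<Longrightarrow> a = (0::'a)"
  by (rule two_torsion) (simp add: eq_neg_iff_add_eq_0)

lemma sign: "\<psi> (mat2 ((-1) ^ k * a) ((-1) ^ k * b) ((-1) ^ k * c) ((-1) ^ k * d)) $ i $ j =
    (-1) ^ k * \<psi> (mat2 a b c d) $ i $ j"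
  using minus[of "mat2 a b c d"] by (cases "even k") simp_all

text \<open>In the identity for \<open>[x, e, \<dots>, e]\<close>, with \<open>x\<close> in the upper right corner, each of the \<open>n - 1\<close>
  entries \<open>e\<close> contributes the same error \<open>q\<close> up to a common sign, while the contributions of
  \<open>\<psi> x\<close> cancel. So \<open>(n - 1) q = 0\<close>.\<close>

lemma unit_commutes:
  "x * \<psi> (mat2 1 0 0 0) $ 2 $ 2 = \<psi> (mat2 1 0 0 0) $ 1 $ 1 * x"
proof -
  define a where "a = \<psi> (mat2 1 0 0 0) $ 1 $ 1"
  define d where "d = \<psi> (mat2 1 0 0 0) $ 2 $ 2"
  define q where "q = x * d - a * x"
  define X where "X = mat2 0 x 0 0"
  define s where "s = (\<lambda>i::nat. if i = 1 then X else mat2 1 0 0 0)"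
  have unit: "\<psi> (mat2 1 0 0 0) = mat2 a 0 0 d"
    using mat2_eta[of "\<psi> (mat2 1 0 0 0)"] unit_diagonal by (simp add: a_def d_def)
  have P: "lie_p (**) (Suc m) s = mat2 0 ((-1) ^ m * x) 0 0" for m
    by (induction m) (simp_all add: s_def X_def)
  have L: "leibniz_sum \<psi> (Suc m) s $ 1 $ 2 = (-1) ^ m * (\<psi> X $ 1 $ 2 - of_nat m * q)" for m
  proof (induction m)
    case 0
    show ?case by (simp add: s_def)
  next
    case (Suc m)
    have "leibniz_sum \<psi> (Suc (Suc m)) s $ 1 $ 2 =
        - leibniz_sum \<psi> (Suc m) s $ 1 $ 2 + bracket (mat2 0 ((-1) ^ m * x) 0 0) (mat2 a 0 0 d) $ 1 $ 2"
      by (simp only: leibniz_sum_Suc P) (simp add: s_def unit bracket_nth)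
    also have "\<dots> = - ((-1) ^ m * (\<psi> X $ 1 $ 2 - of_nat m * q)) + (-1) ^ m * q"
      unfolding Suc.IH by (cases "even m") (simp_all add: q_def)
    finally show ?case by (simp add: algebra_simps)
  qed
  obtain m where m: "n = Suc m" using n_ge_2 by (cases n) auto
  have "(-1) ^ m * \<psi> X $ 1 $ 2 = (-1) ^ m * (\<psi> X $ 1 $ 2 - of_nat m * q)"
    using Lie[of s] L[of m] P[of m] sign[of m 0 x 0 0 1 2] by (simp add: m X_def)
  then have "of_nat (n - 1) * q = 0" by (simp add: m)
  then show ?thesis using n_torsion[of q] by (simp add: q_def a_def d_def)
qed

lemma unit_central: "bracket X (\<psi> (mat2 1 0 0 0)) = 0"
proof -
  define a where "a = \<psi> (mat2 1 0 0 0) $ 1 $ 1"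
  have comm: "x * \<psi> (mat2 1 0 0 0) $ 2 $ 2 = a * x" for x
    using unit_commutes by (simp add: a_def)
  have unit: "\<psi> (mat2 1 0 0 0) = mat2 a 0 0 a"
    using mat2_eta[of "\<psi> (mat2 1 0 0 0)"] unit_diagonal comm[of 1] by (simp add: a_def)
  have "bracket (mat2 w x y z) (mat2 a 0 0 a) = 0" for w x y z
    using comm by (simp add: unit)
  then show ?thesis by (metis mat2_eta unit)
qed

lemma Leibniz_with_unit_tail:
  assumes "n = Suc m + k" and "\<And>i. i > Suc m \<Longrightarrow> x i = mat2 1 0 0 0"
  shows "\<psi> ((ad ^^ k) (lie_p (**) (Suc m) x)) = (ad ^^ k) (leibniz_sum \<psi> (Suc m) x)"
proof -
  have "lie_p (**) (Suc m + k) x = (ad ^^ k) (lie_p (**) (Suc m) x)"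
    by (induction k) (simp_all add: assms(2))
  moreover have "leibniz_sum \<psi> (Suc m + k) x = (ad ^^ k) (leibniz_sum \<psi> (Suc m) x)"
    by (induction k) (simp_all add: assms(2) leibniz_sum_Suc unit_central)
  ultimately show ?thesis using Lie[of x] by (simp add: assms(1))
qed

text \<open>The identity when \<open>e\<close> stands in all but the first one, two or three positions. The third form
  is the one that sees diagonal brackets \<open>[X, Y]\<close> when \<open>n > 2\<close>.\<close>

lemma Leibniz1: "\<psi> ((ad ^^ (n - 1)) X) = (ad ^^ (n - 1)) (\<psi> X)"
  using Leibniz_with_unit_tail[of 0 "n - 1" "\<lambda>i. if i = 1 then X else mat2 1 0 0 0"] n_ge_2
  by simp

lemma Leibniz2:
  "\<psi> ((ad ^^ (n - 2)) (bracket X Y)) = (ad ^^ (n - 2)) (bracket (\<psi> X) Y + bracket X (\<psi> Y))"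
  using Leibniz_with_unit_tail[of 1 "n - 2"
      "\<lambda>i. if i = 1 then X else if i = 2 then Y else mat2 1 0 0 0"] n_ge_2
  by (simp add: leibniz_sum_Suc numeral_2_eq_2)

lemma Leibniz3:
  assumes "n \<ge> 3"
  shows "\<psi> ((ad ^^ (n - 3)) (bracket (bracket X Y) Z)) =
    (ad ^^ (n - 3)) (bracket (bracket (\<psi> X) Y + bracket X (\<psi> Y)) Z + bracket (bracket X Y) (\<psi> Z))"
  using Leibniz_with_unit_tail[of 2 "n - 3"
      "\<lambda>i. if i = 1 then X else if i = 2 then Y else if i = 3 then Z else mat2 1 0 0 0"] assms
  by (simp add: leibniz_sum_Suc numeral_2_eq_2 numeral_3_eq_3)

lemma diagonal_preserved:
  "\<psi> (mat2 a 0 0 d) $ 1 $ 2 = 0" "\<psi> (mat2 a 0 0 d) $ 2 $ 1 = 0"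
proof -
  obtain k where n: "n - 1 = Suc k" using n_ge_2 by (cases "n - 1") auto
  have "(ad ^^ (n - 1)) (\<psi> (mat2 a 0 0 d)) = 0"
    using Leibniz1[of "mat2 a 0 0 d"] by (simp only: n ad_power_Suc) (simp add: mat2_zero zero)
  then have "(ad ^^ Suc k) (mat2 (\<psi> (mat2 a 0 0 d) $ 1 $ 1) (\<psi> (mat2 a 0 0 d) $ 1 $ 2)
      (\<psi> (mat2 a 0 0 d) $ 2 $ 1) (\<psi> (mat2 a 0 0 d) $ 2 $ 2)) = 0"
    by (simp only: n mat2_eta)
  then show "\<psi> (mat2 a 0 0 d) $ 1 $ 2 = 0" "\<psi> (mat2 a 0 0 d) $ 2 $ 1 = 0"
    unfolding ad_power_Suc using neg_one_power_cancel[of k _ 0] by auto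
qed

text \<open>The sign attached to the upper right corner is what separates the two corners later on.\<close>

lemma offdiagonal_power:
  "\<psi> (mat2 0 ((-1) ^ (n - 1) * b) c 0) =
    mat2 0 ((-1) ^ (n - 1) * \<psi> (mat2 0 b c 0) $ 1 $ 2) (\<psi> (mat2 0 b c 0) $ 2 $ 1) 0"
proof -
  have "(ad ^^ (n - 1)) (mat2 (\<psi> (mat2 0 b c 0) $ 1 $ 1) (\<psi> (mat2 0 b c 0) $ 1 $ 2)
      (\<psi> (mat2 0 b c 0) $ 2 $ 1) (\<psi> (mat2 0 b c 0) $ 2 $ 2)) = 
      mat2 0 ((-1) ^ (n - 1) * \<psi> (mat2 0 b c 0) $ 1 $ 2) (\<psi> (mat2 0 b c 0) $ 2 $ 1) 0"
    using n_ge_2 by (intro ad_power_offdiagonal_part) auto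
  then show ?thesis
    using Leibniz1[of "mat2 0 b c 0"] by (simp add: ad_power_offdiagonal mat2_eta)
qed

lemma offdiagonal_preserved:
  "\<psi> (mat2 0 b c 0) $ 1 $ 1 = 0" "\<psi> (mat2 0 b c 0) $ 2 $ 2 = 0"
proof -
  have "(- 1) ^ (n - 1) * ((- 1) ^ (n - 1) * b) = b"
    by (cases "even (n - 1)") simp_all
  then show "\<psi> (mat2 0 b c 0) $ 1 $ 1 = 0" "\<psi> (mat2 0 b c 0) $ 2 $ 2 = 0"
    using offdiagonal_power[of "(-1) ^ (n - 1) * b" c] by simp_all
qed

lemma offdiagonal_form: "\<psi> (mat2 0 b c 0) = mat2 0 (\<psi> (mat2 0 b c 0) $ 1 $ 2) (\<psi> (mat2 0 b c 0) $ 2 $ 1) 0"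
  using mat2_eta[of "\<psi> (mat2 0 b c 0)"] offdiagonal_preserved[of b c] by simp

text \<open>For even \<open>n\<close> the bracketing with \<open>e\<close> acts by \<open>-1\<close> on one corner and by \<open>1\<close> on the other, so an
  additive map commuting with it cannot mix them. For odd \<open>n\<close> the \<open>n - 1\<close> brackets act trivially on
  both corners; instead one uses that the commutator \<open>h\<close> of the two off-diagonal matrix units acts
  by \<open>2\<close> on one corner and by \<open>-2\<close> on the other, so that a stray component \<open>q\<close> satisfies
  \<open>2 q = - 2 q\<close>.\<close>

lemma corner_12_to_12: "\<psi> (mat2 0 x 0 0) $ 2 $ 1 = 0"
  and corner_21_to_21: "\<psi> (mat2 0 0 x 0) $ 1 $ 2 = 0"
proof -
  have "\<psi> (mat2 0 x 0 0) $ 2 $ 1 = 0 \<and> \<psi> (mat2 0 0 x 0) $ 1 $ 2 = 0"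
  proof (cases "even n")
    case True
    then have "\<psi> (- mat2 0 x 0 0) $ 2 $ 1 = \<psi> (mat2 0 x 0 0) $ 2 $ 1"
      and 21: "\<psi> (mat2 0 0 x 0) $ 1 $ 2 = - \<psi> (mat2 0 0 x 0) $ 1 $ 2"
      using offdiagonal_power[of x 0] offdiagonal_power[of 0 x] n_ge_2
      by (simp_all add: mat2_eq_iff[of "\<psi> _"])
    then have 12: "\<psi> (mat2 0 x 0 0) $ 2 $ 1 = - \<psi> (mat2 0 x 0 0) $ 2 $ 1"
      by (simp only: minus) simp
    show ?thesis using zero_if_eq_neg[OF 12] zero_if_eq_neg[OF 21] ..
  next
    case False
    then have n3: "n \<ge> 3" and sign: "(-1) ^ (n - 3) = (1::'a)"
      using n_ge_2 by (auto simp: le_less)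
    define u where "u = \<psi> (mat2 0 1 0 0) $ 1 $ 2"
    define u' where "u' = \<psi> (mat2 0 1 0 0) $ 2 $ 1"
    define v where "v = \<psi> (mat2 0 0 1 0) $ 1 $ 2"
    define v' where "v' = \<psi> (mat2 0 0 1 0) $ 2 $ 1"
    have units: "\<psi> (mat2 0 1 0 0) = mat2 0 u u' 0" "\<psi> (mat2 0 0 1 0) = mat2 0 v v' 0"
      unfolding u_def u'_def v_def v'_def by (rule offdiagonal_form)+
    have double: "\<psi> (mat2 0 (x + x) 0 0) = \<psi> (mat2 0 x 0 0) + \<psi> (mat2 0 x 0 0)"
      "\<psi> (mat2 0 0 (- x - x) 0) = - (\<psi> (mat2 0 0 x 0) + \<psi> (mat2 0 0 x 0))"
      using add[of "mat2 0 x 0 0" "mat2 0 x 0 0"] diff[of "- mat2 0 0 x 0" "mat2 0 0 x 0"]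
      by (simp_all add: minus[of "mat2 0 0 x 0", simplified])
    obtain p q p' q' where x:
        "\<psi> (mat2 0 x 0 0) = mat2 0 p q 0" "\<psi> (mat2 0 0 x 0) = mat2 0 q' p' 0"
      using offdiagonal_form[of x 0] offdiagonal_form[of 0 x] by blast
    have 4: "(q + q) + (q + q) = 0" "(q' + q') + (q' + q') = 0"
      using Leibniz3[OF n3, of "mat2 0 1 0 0" "mat2 0 0 1 0" "mat2 0 x 0 0"]
        Leibniz3[OF n3, of "mat2 0 1 0 0" "mat2 0 0 1 0" "mat2 0 0 x 0"]
      by (simp_all add: x units double sign ad_power_offdiagonal eq_neg_iff_add_eq_0
          neg_eq_iff_add_eq_0 algebra_simps)
    show ?thesis
      using 4[THEN two_torsion, THEN two_torsion] by (simp add: x)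
  qed
  then show "\<psi> (mat2 0 x 0 0) $ 2 $ 1 = 0" "\<psi> (mat2 0 0 x 0) $ 1 $ 2 = 0" by simp_all
qed

definition \<alpha> :: "'a \<Rightarrow> 'a" where "\<alpha> a = \<psi> (mat2 a 0 0 0) $ 1 $ 1"
definition \<beta> :: "'a \<Rightarrow> 'a" where "\<beta> a = \<psi> (mat2 a 0 0 0) $ 2 $ 2"
definition \<gamma> :: "'a \<Rightarrow> 'a" where "\<gamma> d = \<psi> (mat2 0 0 0 d) $ 1 $ 1"
definition \<delta> :: "'a \<Rightarrow> 'a" where "\<delta> d = \<psi> (mat2 0 0 0 d) $ 2 $ 2"
definition \<mu> :: "'a \<Rightarrow> 'a" where "\<mu> b = \<psi> (mat2 0 b 0 0) $ 1 $ 2"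
definition \<nu> :: "'a \<Rightarrow> 'a" where "\<nu> c = \<psi> (mat2 0 0 c 0) $ 2 $ 1"

lemma corner_forms:
  "\<psi> (mat2 a 0 0 0) = mat2 (\<alpha> a) 0 0 (\<beta> a)"
  "\<psi> (mat2 0 b 0 0) = mat2 0 (\<mu> b) 0 0"
  "\<psi> (mat2 0 0 c 0) = mat2 0 0 (\<nu> c) 0"
  "\<psi> (mat2 0 0 0 d) = mat2 (\<gamma> d) 0 0 (\<delta> d)"
  by (simp_all add: mat2_eq_iff[of "\<psi> _"] \<alpha>_def \<beta>_def \<gamma>_def \<delta>_def \<mu>_def \<nu>_def
      diagonal_preserved offdiagonal_preserved corner_12_to_12 corner_21_to_21)

lemma psi_mat2: "\<psi> (mat2 a b c d) = mat2 (\<alpha> a + \<gamma> d) (\<mu> b) (\<nu> c) (\<beta> a + \<delta> d)"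
  using add[of "mat2 a b 0 0" "mat2 0 0 c d"] add[of "mat2 a 0 0 0" "mat2 0 b 0 0"]
    add[of "mat2 0 0 c 0" "mat2 0 0 0 d"]
  by (simp add: corner_forms)

lemma corner_maps_add:
  "\<alpha> (x + y) = \<alpha> x + \<alpha> y" "\<beta> (x + y) = \<beta> x + \<beta> y" "\<gamma> (x + y) = \<gamma> x + \<gamma> y"
  "\<mu> (x + y) = \<mu> x + \<mu> y"
  using add[of "mat2 x 0 0 0" "mat2 y 0 0 0"] add[of "mat2 0 x 0 0" "mat2 0 y 0 0"]
    add[of "mat2 0 0 0 x" "mat2 0 0 0 y"] by (simp_all add: corner_forms)

lemma corner_maps_minus: "\<gamma> (- x) = - \<gamma> x" "\<delta> (- x) = - \<delta> x" "\<mu> (- x) = - \<mu> x"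
  using minus[of "mat2 0 0 0 x"] minus[of "mat2 0 x 0 0"] by (simp_all add: corner_forms)

lemma corner_maps_zero: "\<mu> 0 = 0" "\<nu> 0 = 0"
  using zero by (simp_all add: \<mu>_def \<nu>_def mat2_zero)

text \<open>Since \<open>\<psi>\<close> preserves each corner, the signs produced by the entries \<open>e\<close> can be dropped.\<close>

lemma cancel_ad_power:
  assumes "\<psi> ((ad ^^ k) (mat2 0 b c 0)) = (ad ^^ k) (mat2 0 b' c' 0)"
  shows "\<mu> b = b'" "\<nu> c = c'"
  using assms sign[of k 0 b 0 0 1 2]
  by (simp_all add: ad_power_offdiagonal psi_mat2)

text \<open>The matrices \<open>diag(x, 0)\<close> and \<open>diag(0, y)\<close> commute, and the Leibniz sum of their bracket is
  the diagonal matrix of the two commutators below. It is zero for \<open>n = 2\<close>; for larger \<open>n\<close> it is only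
  seen to commute with the matrix that has \<open>z\<close> in its upper right corner.\<close>

lemma opposite_corners:
  "(x * \<gamma> y - \<gamma> y * x) * z = z * (\<beta> x * y - y * \<beta> x)"
proof (cases "n = 2")
  case True
  then show ?thesis
    using Leibniz2[of "mat2 x 0 0 0" "mat2 0 0 0 y"] by (simp add: mat2_zero zero corner_forms)
next
  case False
  then have n3: "n \<ge> 3" using n_ge_2 by simp
  have "\<psi> ((ad ^^ (n - 3)) (mat2 0 0 0 0)) =
      (ad ^^ (n - 3)) (mat2 0 ((x * \<gamma> y - \<gamma> y * x) * z - z * (\<beta> x * y - y * \<beta> x)) 0 0)"
    using Leibniz3[OF n3, of "mat2 x 0 0 0" "mat2 0 0 0 y" "mat2 0 z 0 0"]
    by (simp add: corner_forms)
  from cancel_ad_power(1)[OF this] show ?thesis by (simp add: corner_maps_zero)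
qed

lemma \<beta>_\<gamma>_central: "\<beta> x * y = y * \<beta> x" "\<gamma> x * y = y * \<gamma> x"
proof -
  have eq: "a * \<gamma> b - \<gamma> b * a = \<beta> a * b - b * \<beta> a" for a b
    using opposite_corners[of a b 1] by simp
  have comm: "(\<beta> a * b - b * \<beta> a) * z = z * (\<beta> a * b - b * \<beta> a)" for a b z
    using opposite_corners[of a b z] by (simp add: eq)
  show *: "\<beta> x * y = y * \<beta> x" for x y
    using central_commutators[OF comm] .
  show "\<gamma> x * y = y * \<gamma> x" using eq[of y x] * by simp
qed

text \<open>A commutator of a diagonal and an off-diagonal corner is a single product. As \<open>\<beta>\<close> and \<open>\<gamma>\<close> are
  central valued, they merely shift \<open>\<alpha>\<close> and \<open>\<delta>\<close> in the resulting Leibniz rules.\<close>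

lemma corner_products:
  "\<mu> (x * y) = (\<alpha> x - \<beta> x) * y + x * \<mu> y"
  "\<mu> (y * x) = \<mu> y * x + y * (\<delta> x - \<gamma> x)"
  "\<nu> (y * x) = \<nu> y * x + y * (\<alpha> x - \<beta> x)"
proof -
  have "\<psi> ((ad ^^ (n - 2)) (mat2 0 (x * y) 0 0)) =
      (ad ^^ (n - 2)) (mat2 0 ((\<alpha> x - \<beta> x) * y + x * \<mu> y) 0 0)"
    using Leibniz2[of "mat2 x 0 0 0" "mat2 0 y 0 0"]
    by (simp add: corner_forms \<beta>_\<gamma>_central(1)[of x y] left_diff_distrib right_diff_distrib)
  from cancel_ad_power(1)[OF this] show "\<mu> (x * y) = (\<alpha> x - \<beta> x) * y + x * \<mu> y" .
  have "\<psi> ((ad ^^ (n - 2)) (mat2 0 (y * x) 0 0)) =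
      (ad ^^ (n - 2)) (mat2 0 (\<mu> y * x + y * (\<delta> x - \<gamma> x)) 0 0)"
    using Leibniz2[of "mat2 0 y 0 0" "mat2 0 0 0 x"]
    by (simp add: corner_forms \<beta>_\<gamma>_central(2)[of x y] left_diff_distrib right_diff_distrib)
  from cancel_ad_power(1)[OF this] show "\<mu> (y * x) = \<mu> y * x + y * (\<delta> x - \<gamma> x)" .
  have "\<psi> ((ad ^^ (n - 2)) (mat2 0 0 (y * x) 0)) =
      (ad ^^ (n - 2)) (mat2 0 0 (\<nu> y * x + y * (\<alpha> x - \<beta> x)) 0)"
    using Leibniz2[of "mat2 0 0 y 0" "mat2 x 0 0 0"]
    by (simp add: corner_forms \<beta>_\<gamma>_central(1)[of x y] left_diff_distrib right_diff_distrib)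
  from cancel_ad_power(2)[OF this] show "\<nu> (y * x) = \<nu> y * x + y * (\<alpha> x - \<beta> x)" .
qed

lemma unit_corner_maps: "\<alpha> 1 = \<beta> 1" "\<delta> 1 = \<gamma> 1"
  using corner_products(1,2)[of 1 1] by simp_all

text \<open>Only products of the two opposite corners relate \<open>\<mu>\<close> and \<open>\<nu>\<close>, and by the preceding
  rules it is enough to look at the matrix units. For \<open>n = 2\<close> their bracket is \<open>diag(1, -1)\<close>, which
  can be compared directly; for larger \<open>n\<close> it is made visible by its action on a third matrix unit.\<close>

lemma \<mu>_\<nu>_one: "\<nu> 1 = - \<mu> 1"
proof -
  have "(\<mu> 1 + \<nu> 1) + (\<mu> 1 + \<nu> 1) = 0"
  proof (cases "n = 2")
    case True
    then have "\<alpha> 1 - \<gamma> 1 = \<mu> 1 + \<nu> 1" "\<beta> 1 - \<delta> 1 = - (\<mu> 1 + \<nu> 1)"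
      using Leibniz2[of "mat2 0 1 0 0" "mat2 0 0 1 0"]
      by (simp_all add: psi_mat2 corner_maps_zero corner_maps_minus algebra_simps)
    then have "\<mu> 1 + \<nu> 1 = - (\<mu> 1 + \<nu> 1)" by (simp only: unit_corner_maps)
    then show ?thesis by (simp only: eq_neg_iff_add_eq_0)
  next
    case False
    then have n3: "n \<ge> 3" using n_ge_2 by simp
    have "\<psi> ((ad ^^ (n - 3)) (mat2 0 (1 + 1) 0 0)) =
        (ad ^^ (n - 3)) (mat2 0 ((\<mu> 1 + \<nu> 1) + (\<mu> 1 + \<nu> 1) + (\<mu> 1 + \<mu> 1)) 0 0)"
      using Leibniz3[OF n3, of "mat2 0 1 0 0" "mat2 0 0 1 0" "mat2 0 1 0 0"]
      by (simp add: corner_forms algebra_simps)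
    from cancel_ad_power(1)[OF this] show ?thesis
      by (simp only: corner_maps_add add_cancel_right_left)
  qed
  then have "\<mu> 1 + \<nu> 1 = 0" by (rule two_torsion)
  then show ?thesis by (simp add: eq_neg_iff_add_eq_0 add.commute)
qed

definition D :: "'a \<Rightarrow> 'a" where "D a = \<alpha> a - \<beta> a"

text \<open>These are the formulas for an entrywise derivation plus the bracket with \<open>diag(0, \<mu> 1)\<close>.\<close>

lemma corner_maps_via_D:
  "\<mu> x = D x + x * \<mu> 1" "\<nu> x = D x - \<mu> 1 * x" "\<delta> x - \<gamma> x = D x + x * \<mu> 1 - \<mu> 1 * x"
proof -
  show \<mu>: "\<mu> x = D x + x * \<mu> 1"
    using corner_products(1)[of x 1] by (simp add: D_def)
  show "\<nu> x = D x - \<mu> 1 * x"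
    using corner_products(3)[of 1 x] by (simp add: D_def \<mu>_\<nu>_one)
  have "\<mu> x = \<mu> 1 * x + (\<delta> x - \<gamma> x)"
    using corner_products(2)[of 1 x] by simp
  then show "\<delta> x - \<gamma> x = D x + x * \<mu> 1 - \<mu> 1 * x"
    unfolding \<mu> by (simp add: algebra_simps)
qed

lemma D_mult: "D (x * y) = D x * y + x * D y"
  using corner_products(1)[of x y]
  unfolding corner_maps_via_D(1)[of "x * y"] corner_maps_via_D(1)[of y] D_def[symmetric]
  by (simp add: algebra_simps)

lemma D_add: "D (x + y) = D x + D y"
  by (simp add: D_def corner_maps_add)

definition entrywise_D :: "'a ^ 2 ^ 2 \<Rightarrow> 'a ^ 2 ^ 2" where
  "entrywise_D X = mat2 (D (X $ 1 $ 1)) (D (X $ 1 $ 2)) (D (X $ 2 $ 1)) (D (X $ 2 $ 2))"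

definition central_part :: "'a ^ 2 ^ 2 \<Rightarrow> 'a ^ 2 ^ 2" where
  "central_part X = mat2 (\<beta> (X $ 1 $ 1) + \<gamma> (X $ 2 $ 2)) 0 0 (\<beta> (X $ 1 $ 1) + \<gamma> (X $ 2 $ 2))"

lemma central_part_central: "central_part X ** Y = Y ** central_part X"
  using \<beta>_\<gamma>_central
  by (simp add: mat2_eq_iff[of "_ ** _"] mat2_mult_nth central_part_def distrib_left distrib_right)

lemma psi_decomposition:
  "\<psi> X = entrywise_D X + bracket X (mat2 0 0 0 (\<mu> 1)) + central_part X"
proof -
  have "\<delta> x = D x + x * \<mu> 1 - \<mu> 1 * x + \<gamma> x" for x
    using corner_maps_via_D(3)[of x] by (simp add: algebra_simps)
  then have "\<psi> (mat2 a b c d) = entrywise_D (mat2 a b c d)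
      + bracket (mat2 a b c d) (mat2 0 0 0 (\<mu> 1)) + central_part (mat2 a b c d)" for a b c d
    unfolding psi_mat2 corner_maps_via_D(1)[of b] corner_maps_via_D(2)[of c]
    by (simp add: entrywise_D_def central_part_def D_def)
  then show ?thesis by (metis mat2_eta)
qed

lemma minus_central_part_mult:
  "\<psi> (X ** Y) - central_part (X ** Y) =
    (\<psi> X - central_part X) ** Y + X ** (\<psi> Y - central_part Y)"
proof -
  have entry: "entrywise_D (X ** Y) = entrywise_D X ** Y + X ** entrywise_D Y" for X Y
    unfolding mat2_eq_iff[of "entrywise_D (X ** Y)"]
    by (simp add: entrywise_D_def mat2_mult_nth D_add D_mult add_ac)
  have "\<psi> Z - central_part Z = entrywise_D Z + bracket Z (mat2 0 0 0 (\<mu> 1))" for Z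
    by (simp add: psi_decomposition[of Z])
  then show ?thesis
    by (simp add: entry inner_derivation_mult matrix_add_ldistrib matrix_add_rdistrib)
qed

end

section \<open>Removing the inner part\<close>

theorem corollary3p5:
  fixes scl :: "'r::comm_ring_1 \<Rightarrow> 'a::ring_1 \<Rightarrow> 'a"
    and n :: nat
    and \<phi> :: "'a ^ 2 ^ 2 \<Rightarrow> 'a ^ 2 ^ 2"
  assumes "n \<ge> 2"
    and "unital_algebra scl"
    and "torsion_free TYPE('a ^ 2 ^ 2) 2"
    and "torsion_free TYPE('a ^ 2 ^ 2) (n - 1)"
    and "commutative_algebra ((*) :: 'a \<Rightarrow> 'a \<Rightarrow> 'a) \<or>
         (\<not> commutative_algebra ((*) :: 'a \<Rightarrow> 'a \<Rightarrow> 'a) \<and> prime_algebra ((*) :: 'a \<Rightarrow> 'a \<Rightarrow> 'a))"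
    and "Lie_n_derivation (mat_scale scl) (**) n \<phi>"
  shows "standard_map (mat_scale scl) (**) n \<phi>"
proof -
  interpret unital_algebra scl by fact
  interpret M: module "mat_scale scl :: 'r \<Rightarrow> 'a ^ 2 ^ 2 \<Rightarrow> 'a ^ 2 ^ 2"
    by (rule module_mat_scale)
  interpret \<phi>: module_hom "mat_scale scl" "mat_scale scl" \<phi>
    using assms(6) by (simp add: Lie_n_derivation_def)
  have Lie: "\<phi> (lie_p (**) n x) = leibniz_sum \<phi> n x" for x
    using assms(6) by (simp add: Lie_n_derivation_def leibniz_sum_def)

  define e :: "'a ^ 2 ^ 2" where "e = mat2 1 0 0 0"
  \<comment> \<open>\<open>[e, g]\<close> is the off-diagonal part of \<open>\<phi> e\<close>.\<close>
  define g where "g = mat2 0 (\<phi> e $ 1 $ 2) (- \<phi> e $ 2 $ 1) 0"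
  define \<psi> where "\<psi> = (\<lambda>X. \<phi> X - bracket X g)"
  have \<psi>_add: "\<psi> (X + Y) = \<psi> X + \<psi> Y" for X Y
    by (simp add: \<psi>_def \<phi>.add bracket_add_left)
  have \<psi>_scale: "\<psi> (mat_scale scl r X) = mat_scale scl r (\<psi> X)" for r X
    by (simp add: \<psi>_def \<phi>.scale M.scale_right_diff_distrib commutator_def
        mat_scale_mult_left mat_scale_mult_right)
  have "leibniz_sum (\<lambda>X. bracket X g) n x = bracket (lie_p (**) n x) g" for x
    using assms(1) by (intro leibniz_sum_derivation inner_derivation_bracket) simp
  then have \<psi>_Lie: "\<psi> (lie_p (**) n x) = leibniz_sum \<psi> n x" for x
    by (simp add: \<psi>_def leibniz_sum_diff Lie)

  interpret N: normalised_Lie_derivation \<psi> n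
  proof
    show "\<psi> (mat2 1 0 0 0) $ 1 $ 2 = 0" "\<psi> (mat2 1 0 0 0) $ 2 $ 1 = 0"
      by (simp_all add: \<psi>_def g_def flip: e_def) (simp_all add: e_def)
    show "a = 0" if "a + a = 0" for a :: 'a
      using torsion_free_entries[OF assms(3), of a] that by (simp add: mult_2)
    show "a = 0" if "of_nat (n - 1) * a = 0" for a :: 'a
      using torsion_free_entries[OF assms(4)] that .
    show "b * y = y * b" if "\<And>y z. (b * y - y * b) * z = z * (b * y - y * b)" for b y :: 'a
      using commuting_if_central_commutators[OF _ that] assms(5) by blast
  qed (fact assms(1) \<psi>_add \<psi>_Lie)+

  define \<tau> where "\<tau> = N.central_part"
  define h where "h = (\<lambda>X. \<phi> X - \<tau> X)"
  have \<tau>_hom: "module_hom (mat_scale scl) (mat_scale scl) \<tau>"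
  proof
    have scale_nth: "mat_scale scl r X $ i $ j = scl r (X $ i $ j)" for r i j and X :: "'a ^ 2 ^ 2"
      by (simp add: mat_scale_def)
    have "mat2 (scl r a) 0 0 0 = mat_scale scl r (mat2 a 0 0 0)"
      and "mat2 0 0 0 (scl r a) = mat_scale scl r (mat2 0 0 0 a)" for r a
      by (simp_all add: mat2_eq_iff scale_nth)
    then have "N.\<beta> (scl r a) = scl r (N.\<beta> a)" "N.\<gamma> (scl r a) = scl r (N.\<gamma> a)" for r a
      by (simp_all add: N.\<beta>_def N.\<gamma>_def \<psi>_scale scale_nth)
    then show "\<tau> (mat_scale scl r X) = mat_scale scl r (\<tau> X)" for r X
      by (simp add: mat2_eq_iff \<tau>_def N.central_part_def scale_nth scale_right_distrib)
    show "\<tau> (X + Y) = \<tau> X + \<tau> Y" for X Y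
      by (simp add: \<tau>_def N.central_part_def N.corner_maps_add add_ac)
  qed
  have \<tau>_central: "\<tau> X ** Y = Y ** \<tau> X" for X Y
    unfolding \<tau>_def by (rule N.central_part_central)
  have h_mult: "h (X ** Y) = h X ** Y + X ** h Y" for X Y
  proof -
    have "h = (\<lambda>X. (\<psi> X - \<tau> X) + bracket X g)"
      by (simp add: h_def \<psi>_def)
    then show ?thesis
      using N.minus_central_part_mult[of X Y]
      by (simp add: \<tau>_def inner_derivation_mult matrix_add_ldistrib matrix_add_rdistrib)
  qed
  have "h (bracket X Y) = bracket (h X) Y + bracket X (h Y)" for X Y
  proof -
    have "h (A - B) = h A - h B" for A B
      by (simp add: h_def \<phi>.diff module_hom.diff[OF \<tau>_hom])
    then show ?thesis by (simp add: commutator_def h_mult)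
  qed
  then have "leibniz_sum h n x = h (lie_p (**) n x)" for x
    using assms(1) by (intro leibniz_sum_derivation) simp_all
  moreover have "leibniz_sum \<tau> n x = 0" for x
    using assms(1) by (intro leibniz_sum_central) (simp_all add: commutator_def \<tau>_central)
  ultimately have "\<tau> (lie_p (**) n x) = 0" for x
    unfolding h_def by (simp add: leibniz_sum_diff Lie)
  moreover have "derivation (mat_scale scl) (**) h"
    unfolding derivation_def
  proof (intro conjI allI h_mult)
    show "module_hom (mat_scale scl) (mat_scale scl) h"
      by unfold_locales (simp_all add: h_def \<phi>.add \<phi>.scale module_hom.add[OF \<tau>_hom]
          module_hom.scale[OF \<tau>_hom] M.scale_right_diff_distrib)
  qed
  ultimately show ?thesis
    unfolding standard_map_def algebra_centre_def
    using \<tau>_hom \<tau>_central by (intro exI[of _ h] exI[of _ \<tau>]) (auto simp: h_def)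
qed

end
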